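(* Let $f\in L^1(\Omega,\mu)$ be such that there exist $g\in L^1(\Omega,\mu)$ and a representative $f^\sharp$ of $f$ (i.e. $f^\sharp=f$ $\mu$-a.e.) such that, for $\mu$-almost every $x\in\Omega$ and any $-\tau_-(x)<t_1\le t_2<\tau_+(x)$, $$f^\sharp(\Phi(x,t_1))-f^\sharp(\Phi(x,t_2))=\int_{t_1}^{t_2}g(\Phi(x,s))\,ds .$$ Then $\lim_{t\to0+}f^\sharp(\Phi(y,t))$ exists for $\mu_-$-almost every $y\in\Gamma_-$. Similarly, $\lim_{t\to0+}f^\sharp(\Phi(y,-t))$ exists for $\mu_+$-almost every $y\in\Gamma_+$.
   Context: Setting. $\mu$ is a positive Radon measure on $\mathbb R^N$ (a Borel measure, or the completion of one, finite on compact sets). $F:\mathbb R^N\to\mathbb R^N$ is a globally Lipschitz vector field. For $x\in\mathbb R^N$, $t\mapsto\Phi(x,t)$, $t\in\mathbb R$, is the unique global solution of $\frac{d}{dt}X(t)=F(X(t))$, $X(0)=x$. Standing assumption: $\mu(\Phi(A,t))=\mu(A)$ for every measurable $A\subset\mathbb R^N$ and $t\in\mathbb R$. $\Omega\subset\mathbb R^N$ is a (sufficiently smooth) open set. For $x\in\Omega$, $\tau_\pm(x)=\inf\{s>0:\Phi(x,\pm s)\notin\Omega\}$, with $\inf\varnothing=\infty$. The incoming ($-$) and outgoing ($+$) boundaries are $\Gamma_\pm=\{y\in\partial\Omega:\exists x\in\Omega,\ \tau_\pm(x)<\infty,\ y=\Phi(x,\pm\tau_\pm(x))\}$. For $y\in\Gamma_-$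 (resp. $y\in\Gamma_+$), $\tau_+(y)$ (resp. $\tau_-(y)$) is the length of the integral curve in $\Omega$ having $y$ as left (resp. right) endpoint, i.e. $\tau_-(x)+\tau_+(x)$ for any $x\in\Omega$ with $y=\Phi(x,-\tau_-(x))$ (resp. $y=\Phi(x,\tau_+(x))$). Boundary measures: $\mu_\pm$ are the unique positive Borel measures on $\Gamma_\pm$ such that for all $T>0$ and $f\in L^1(\Omega\times(0,T),\mu\otimes dt)$, with $\wedge$ denoting minimum, $\int_{\Omega\times(0,T)}f\,d\mu\,dt=\int_0^Tdt\int_{\Gamma_+}d\mu_+(y)\int_0^{\tau_-(y)\wedge t}f(\Phi(y,-s),t-s)ds+\int_\Omega d\mu(x)\int_0^{\tau_-(x)\wedge T}f(\Phi(x,-s),T-s)ds$ and $\int_{\Omega\times(0,T)}f\,d\mu\,dt=\int_0^Tdt\int_{\Gamma_-}d\mu_-(y)\int_0^{\tau_+(y)\wedge(T-t)}f(\Phi(y,s),t+s)ds+\int_\Omega d\mu(x)\int_0^{\tau_+(x)\wedge T}f(\Phi(x,s),s)ds$. *)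

theory Defs
  imports "HOL-Analysis.Analysis"
begin

definition radon_measure :: "'a::topological_space measure \<Rightarrow> bool" where
  "radon_measure \<mu> \<longleftrightarrow>
     (\<exists>\<nu>. sets \<nu> = sets borel \<and> (\<mu> = \<nu> \<or> \<mu> = completion \<nu>)) \<and>
     (\<forall>K. compact K \<longrightarrow> emeasure \<mu> K < \<infinity>)"

(* For globally Lipschitz F this determines Phi uniquely (Picard-Lindeloef). *)
definition is_flow_of ::
    "('a::real_normed_vector \<Rightarrow> 'a) \<Rightarrow> ('a \<Rightarrow> real \<Rightarrow> 'a) \<Rightarrow> bool" where
  "is_flow_of F \<Phi> \<longleftrightarrow>
     (\<forall>x. \<Phi> x 0 = x \<and> (\<forall>t. (\<Phi> x has_vector_derivative F (\<Phi> x t)) (at t)))"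

definition flow_invariant :: "('a \<Rightarrow> real \<Rightarrow> 'a) \<Rightarrow> 'a measure \<Rightarrow> bool" where
  "flow_invariant \<Phi> \<mu> \<longleftrightarrow>
     (\<forall>A\<in>sets \<mu>. \<forall>t. emeasure \<mu> ((\<lambda>x. \<Phi> x t) ` A) = emeasure \<mu> A)"


definition tau_plus :: "('a \<Rightarrow> real \<Rightarrow> 'a) \<Rightarrow> 'a set \<Rightarrow> 'a \<Rightarrow> ereal" where
  "tau_plus \<Phi> \<Omega> x = (INF s\<in>{s. 0 < s \<and> \<Phi> x s \<notin> \<Omega>}. ereal s)"

definition tau_minus :: "('a \<Rightarrow> real \<Rightarrow> 'a) \<Rightarrow> 'a set \<Rightarrow> 'a \<Rightarrow> ereal" where
  "tau_minus \<Phi> \<Omega> x = (INF s\<in>{s. 0 < s \<and> \<Phi> x (- s) \<notin> \<Omega>}. ereal s)"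

definition exits_at :: "('a \<Rightarrow> real \<Rightarrow> 'a) \<Rightarrow> 'a set \<Rightarrow> 'a \<Rightarrow> 'a \<Rightarrow> bool" where
  "exits_at \<Phi> \<Omega> x y \<longleftrightarrow>
     x \<in> \<Omega> \<and> tau_plus \<Phi> \<Omega> x < \<infinity> \<and> y = \<Phi> x (real_of_ereal (tau_plus \<Phi> \<Omega> x))"

definition enters_at :: "('a \<Rightarrow> real \<Rightarrow> 'a) \<Rightarrow> 'a set \<Rightarrow> 'a \<Rightarrow> 'a \<Rightarrow> bool" where
  "enters_at \<Phi> \<Omega> x y \<longleftrightarrow>
     x \<in> \<Omega> \<and> tau_minus \<Phi> \<Omega> x < \<infinity> \<and> y = \<Phi> x (- real_of_ereal (tau_minus \<Phi> \<Omega> x))"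

definition Gamma_plus :: "('a::topological_space \<Rightarrow> real \<Rightarrow> 'a) \<Rightarrow> 'a set \<Rightarrow> 'a set" where
  "Gamma_plus \<Phi> \<Omega> = {y \<in> frontier \<Omega>. \<exists>x. exits_at \<Phi> \<Omega> x y}"

definition Gamma_minus :: "('a::topological_space \<Rightarrow> real \<Rightarrow> 'a) \<Rightarrow> 'a set \<Rightarrow> 'a set" where
  "Gamma_minus \<Phi> \<Omega> = {y \<in> frontier \<Omega>. \<exists>x. enters_at \<Phi> \<Omega> x y}"

(* Length of the integral curve in Omega ending at y in Gamma_plus (written tau_-(y)),
   resp. starting at y in Gamma_minus (written tau_+(y)); for a flow and open Omega the
   value does not depend on the chosen x. They are kept apart from tau_plus and tau_minus,
   which are meant for points of Omega. *)
definition length_to :: "('a \<Rightarrow> real \<Rightarrow> 'a) \<Rightarrow> 'a set \<Rightarrow> 'a \<Rightarrow> ereal" where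
  "length_to \<Phi> \<Omega> y =
     (let x = (SOME x. exits_at \<Phi> \<Omega> x y) in tau_minus \<Phi> \<Omega> x + tau_plus \<Phi> \<Omega> x)"

definition length_from :: "('a \<Rightarrow> real \<Rightarrow> 'a) \<Rightarrow> 'a set \<Rightarrow> 'a \<Rightarrow> ereal" where
  "length_from \<Phi> \<Omega> y =
     (let x = (SOME x. enters_at \<Phi> \<Omega> x y) in tau_minus \<Phi> \<Omega> x + tau_plus \<Phi> \<Omega> x)"


definition lebesgue_upto :: "ereal \<Rightarrow> real measure" where
  "lebesgue_upto a = restrict_space lborel {s. 0 < s \<and> ereal s < a}"

definition iterated_integral ::
    "'a measure \<Rightarrow> ('a \<Rightarrow> 'b measure) \<Rightarrow> ('a \<Rightarrow> 'b \<Rightarrow> real) \<Rightarrow> real" where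
  "iterated_integral M K h = (\<integral>x. (\<integral>s. h x s \<partial>K x) \<partial>M)"

definition iterated_integrable ::
    "'a measure \<Rightarrow> ('a \<Rightarrow> 'b measure) \<Rightarrow> ('a \<Rightarrow> 'b \<Rightarrow> real) \<Rightarrow> bool" where
  "iterated_integrable M K h \<longleftrightarrow>
     (AE x in M. integrable (K x) (h x)) \<and> integrable M (\<lambda>x. \<integral>s. h x s \<partial>K x)"

(* The two identities characterising the boundary measures. An element of
   L^1(Omega x (0,T)) is given by a Borel representative, so that the inner integrands are
   measurable also when mu is a completed measure. The integrability clauses express that
   the integrals on the right converge: the Bochner integral of a non-integrable function
   is 0, and without them the identities would not determine the measures. *)
definition outgoing_boundary_measure ::
    "'a::euclidean_space measure \<Rightarrow> ('a \<Rightarrow> real \<Rightarrow> 'a) \<Rightarrow> 'a set \<Rightarrow> 'a measure \<Rightarrow> bool" where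
  "outgoing_boundary_measure \<mu> \<Phi> \<Omega> \<mu>p \<longleftrightarrow>
     sets \<mu>p = sets (restrict_space borel (Gamma_plus \<Phi> \<Omega>)) \<and>
     (\<forall>T f. 0 < T \<longrightarrow> f \<in> borel_measurable borel \<longrightarrow>
       set_integrable (\<mu> \<Otimes>\<^sub>M lborel) (\<Omega> \<times> {0<..<T}) f \<longrightarrow>
       (let K = (\<lambda>t y. lebesgue_upto (min (length_to \<Phi> \<Omega> y) (ereal t)));
            h = (\<lambda>t y s. f (\<Phi> y (- s), t - s));
            K0 = (\<lambda>x. lebesgue_upto (min (tau_minus \<Phi> \<Omega> x) (ereal T)));
            h0 = (\<lambda>x s. f (\<Phi> x (- s), T - s))
        in (AE t in lebesgue_upto T. iterated_integrable \<mu>p (K t) (h t)) \<and>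
           integrable (lebesgue_upto T) (\<lambda>t. iterated_integral \<mu>p (K t) (h t)) \<and>
           iterated_integrable (restrict_space \<mu> \<Omega>) K0 h0 \<and>
           (LINT z:\<Omega> \<times> {0<..<T}|\<mu> \<Otimes>\<^sub>M lborel. f z) =
             (\<integral>t. iterated_integral \<mu>p (K t) (h t) \<partial>lebesgue_upto T) +
             iterated_integral (restrict_space \<mu> \<Omega>) K0 h0))"

definition incoming_boundary_measure ::
    "'a::euclidean_space measure \<Rightarrow> ('a \<Rightarrow> real \<Rightarrow> 'a) \<Rightarrow> 'a set \<Rightarrow> 'a measure \<Rightarrow> bool" where
  "incoming_boundary_measure \<mu> \<Phi> \<Omega> \<mu>m \<longleftrightarrow>
     sets \<mu>m = sets (restrict_space borel (Gamma_minus \<Phi> \<Omega>)) \<and>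
     (\<forall>T f. 0 < T \<longrightarrow> f \<in> borel_measurable borel \<longrightarrow>
       set_integrable (\<mu> \<Otimes>\<^sub>M lborel) (\<Omega> \<times> {0<..<T}) f \<longrightarrow>
       (let K = (\<lambda>t y. lebesgue_upto (min (length_from \<Phi> \<Omega> y) (ereal (T - t))));
            h = (\<lambda>t y s. f (\<Phi> y s, t + s));
            K0 = (\<lambda>x. lebesgue_upto (min (tau_plus \<Phi> \<Omega> x) (ereal T)));
            h0 = (\<lambda>x s. f (\<Phi> x s, s))
        in (AE t in lebesgue_upto T. iterated_integrable \<mu>m (K t) (h t)) \<and>
           integrable (lebesgue_upto T) (\<lambda>t. iterated_integral \<mu>m (K t) (h t)) \<and>
           iterated_integrable (restrict_space \<mu> \<Omega>) K0 h0 \<and>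
           (LINT z:\<Omega> \<times> {0<..<T}|\<mu> \<Otimes>\<^sub>M lborel. f z) =
             (\<integral>t. iterated_integral \<mu>m (K t) (h t) \<partial>lebesgue_upto T) +
             iterated_integral (restrict_space \<mu> \<Omega>) K0 h0))"

end

theory Submission
  imports Defs
begin

text \<open>
  Along an integral curve, \<open>f\<^sup>\<sharp>\<close> is a primitive of \<open>- g\<close>, so it has a limit at the start
  \<open>y \<in> \<Gamma>\<^sub>-\<close> of the curve as soon as two things hold: \<open>g\<close> is integrable along the curve near \<open>y\<close>,
  and the curve contains at least one point \<open>x\<close> at which the identity between \<open>f\<^sup>\<sharp>\<close> and \<open>g\<close> is
  available. One such point suffices, because the identity at \<open>x\<close> concerns all times for which the
  curve through \<open>x\<close> stays in \<open>\<Omega>\<close>, and by the group law \<open>\<Phi> (\<Phi> y s) t = \<Phi> y (s + t)\<close>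
  (\<open>flow_add\<close>) this curve reaches back to \<open>y\<close>.

  Both conditions come from the identity that characterises \<open>\<mu>\<^sub>-\<close>, with \<open>T = 1\<close> and test functions
  \<open>f (x, t) = \<phi> x\<close>. The terms of the identity are then integrals of \<open>\<phi>\<close> along pieces
  of the curves that start on \<open>\<Gamma>\<^sub>-\<close>. Choosing \<open>\<phi> = \<bar>g\<bar>\<close> shows that \<open>g\<close> is integrable along
  \<open>\<mu>\<^sub>-\<close>-almost every curve near its start. Choosing for \<open>\<phi>\<close> the indicator of a Borel null set \<open>N\<close>
  makes the left-hand side vanish; both summands on the right are nonnegative, so they vanish too, and
  almost every curve meets \<open>N\<close> only in a set of times of measure zero. Take for \<open>N\<close> a
  null set outside which the identity holds and \<open>g\<close> agrees with a Borel representative. These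
  consequences are collected in \<open>controls_entrance\<close>; \<open>right_limit_at_entrance\<close> deduces the limit.

  The outgoing boundary of \<open>\<Phi>\<close> is the incoming boundary of the reversed flow
  \<open>\<lambda>x t. \<Phi> x (- t)\<close>, along which \<open>f\<^sup>\<sharp>\<close> is a primitive of \<open>g\<close>. Since \<open>controls_entrance\<close> does not mention
  time-dependent test functions, it follows from either characterisation of the boundary
  measures, and the second claim is the first one for the reversed flow.
\<close>

section \<open>Integral curves of a Lipschitz field\<close>

text \<open>
  Gronwall's argument: \<open>w = \<parallel>X - Y\<parallel>\<^sup>2\<close> satisfies \<open>w' \<le> 2 L w\<close>, so \<open>w t * exp (- 2 L t)\<close> decreases
  from its value \<open>0\<close> at time \<open>0\<close>.
\<close>

lemma lipschitz_ode_unique_forward: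
  fixes F :: "'a::euclidean_space \<Rightarrow> 'a"
  assumes lip: "L-lipschitz_on UNIV F"
    and X: "\<And>t. (X has_vector_derivative F (X t)) (at t)"
    and Y: "\<And>t. (Y has_vector_derivative F (Y t)) (at t)"
    and init: "X 0 = Y 0" and "0 \<le> t"
  shows "X t = Y t"
proof -
  define w where "w = (\<lambda>t. (X t - Y t) \<bullet> (X t - Y t))"
  define w' where "w' = (\<lambda>t. 2 * ((X t - Y t) \<bullet> (F (X t) - F (Y t))))"
  define v where "v = (\<lambda>t. w t * exp (- 2 * L * t))"
  have w': "(w has_real_derivative w' t) (at t)" for t
  proof -
    have "((\<lambda>t. X t - Y t) has_vector_derivative F (X t) - F (Y t)) (at t)"
      by (intro derivative_intros X Y)
    then have d: "((\<lambda>t. X t - Y t) has_derivative (\<lambda>h. h *\<^sub>R (F (X t) - F (Y t)))) (at t)"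
      by (simp add: has_vector_derivative_def)
    have "(w has_derivative (\<lambda>h. (X t - Y t) \<bullet> (h *\<^sub>R (F (X t) - F (Y t)))
            + (h *\<^sub>R (F (X t) - F (Y t))) \<bullet> (X t - Y t))) (at t)"
      unfolding w_def by (intro has_derivative_inner d)
    moreover have "(\<lambda>h. (X t - Y t) \<bullet> (h *\<^sub>R (F (X t) - F (Y t)))
            + (h *\<^sub>R (F (X t) - F (Y t))) \<bullet> (X t - Y t)) = (\<lambda>h. h * w' t)"
      by (auto simp: w'_def inner_commute algebra_simps)
    ultimately show ?thesis
      by (simp add: has_field_derivative_def mult_commute_abs)
  qed
  have growth: "w' s \<le> 2 * L * w s" for s
  proof -
    have "(X s - Y s) \<bullet> (F (X s) - F (Y s)) \<le> norm (X s - Y s) * norm (F (X s) - F (Y s))"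
      by (rule norm_cauchy_schwarz)
    also have "\<dots> \<le> norm (X s - Y s) * (L * norm (X s - Y s))"
      using lipschitz_on_normD[OF lip, of "X s" "Y s"] by (intro mult_left_mono) auto
    also have "\<dots> = L * w s"
      by (simp add: w_def power2_norm_eq_inner[symmetric] power2_eq_square)
    finally show ?thesis by (simp add: w'_def)
  qed
  have "v t \<le> v 0"
  proof (rule DERIV_nonpos_imp_nonincreasing[OF \<open>0 \<le> t\<close>])
    fix s
    have "(v has_real_derivative (w' s - 2 * L * w s) * exp (- 2 * L * s)) (at s)"
      unfolding v_def by (rule derivative_eq_intros w' refl)+ (simp add: algebra_simps)
    moreover have "(w' s - 2 * L * w s) * exp (- 2 * L * s) \<le> 0"
      using growth[of s] by (simp add: mult_nonpos_nonneg)
    ultimately show "\<exists>y. (v has_real_derivative y) (at s) \<and> y \<le> 0" by blast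
  qed
  then have "w t \<le> 0"
    using init by (simp add: v_def w_def mult_le_0_iff)
  then have "w t = 0" using inner_ge_zero[of "X t - Y t"] by (simp add: w_def)
  then show ?thesis by (simp add: w_def)
qed

lemma is_flow_of_reverse:
  assumes "is_flow_of F \<Phi>"
  shows "is_flow_of (\<lambda>x. - F x) (\<lambda>x t. \<Phi> x (- t))"
proof -
  have "((\<lambda>t. \<Phi> x (- t)) has_vector_derivative - F (\<Phi> x (- t))) (at t)" for x t
  proof -
    have "(uminus has_vector_derivative - 1) (at t)"
      by (rule derivative_eq_intros refl)+
    moreover have "(\<Phi> x has_vector_derivative F (\<Phi> x (- t))) (at (- t))"
      using assms by (simp add: is_flow_of_def)
    ultimately show ?thesis
      using vector_diff_chain_at[of uminus "- 1" t "\<Phi> x" "F (\<Phi> x (- t))"]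
      by (simp add: o_def)
  qed
  with assms show ?thesis by (simp add: is_flow_of_def)
qed

text \<open>
  Both sides solve the equation in \<open>t\<close> with the same initial value. Uniqueness covers \<open>t \<ge> 0\<close>;
  negative times are nonnegative times of the reversed flow.
\<close>

lemma flow_add:
  fixes F :: "'a::euclidean_space \<Rightarrow> 'a"
  assumes lip: "L-lipschitz_on UNIV F" and flow: "is_flow_of F \<Phi>"
  shows "\<Phi> (\<Phi> x s) t = \<Phi> x (s + t)"
proof -
  have *: "\<Psi> (\<Psi> x s) t = \<Psi> x (s + t)"
    if "0 \<le> t" and lip': "L-lipschitz_on UNIV G" and fl: "is_flow_of G \<Psi>" for G \<Psi> s t
  proof (rule lipschitz_ode_unique_forward[OF lip' _ _ _ \<open>0 \<le> t\<close>])
    fix r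
    show "(\<Psi> (\<Psi> x s) has_vector_derivative G (\<Psi> (\<Psi> x s) r)) (at r)"
      using fl by (simp add: is_flow_of_def)
    have "(\<Psi> x has_vector_derivative G (\<Psi> x (s + r))) (at (s + r))"
      using fl by (simp add: is_flow_of_def)
    moreover have "((\<lambda>r. s + r) has_vector_derivative 1) (at r)"
      by (rule derivative_eq_intros refl)+ simp
    ultimately show "((\<lambda>r. \<Psi> x (s + r)) has_vector_derivative G (\<Psi> x (s + r))) (at r)"
      using vector_diff_chain_at[of "\<lambda>r. s + r" 1 r "\<Psi> x"] by (simp add: o_def)
  qed (use fl in \<open>simp add: is_flow_of_def\<close>)
  show ?thesis
  proof (cases "0 \<le> t")
    case True
    then show ?thesis using * lip flow by blast
  next
    case False
    have "L-lipschitz_on UNIV (\<lambda>x. - F x)" using lip by (rule lipschitz_on_minus)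
    then show ?thesis
      using *[of "- t" _ "\<lambda>x t. \<Phi> x (- t)" "- s", OF _ _ is_flow_of_reverse[OF flow]] False
      by (simp add: add.commute)
  qed
qed

lemma continuous_flow:
  assumes "is_flow_of F \<Phi>"
  shows "continuous_on UNIV (\<Phi> x)"
  using assms unfolding is_flow_of_def
  by (meson continuous_at_imp_continuous_on has_vector_derivative_continuous)

lemma flow_in_if_less_tau_plus:
  assumes "0 < s" "ereal s < tau_plus \<Phi> \<Omega> x"
  shows "\<Phi> x s \<in> \<Omega>"
proof (rule ccontr)
  assume "\<Phi> x s \<notin> \<Omega>"
  then have "tau_plus \<Phi> \<Omega> x \<le> ereal s"
    unfolding tau_plus_def using assms(1) by (intro INF_lower) auto
  with assms(2) show False by simp
qed

lemma tau_plus_reverse: "tau_plus (\<lambda>x t. \<Phi> x (- t)) \<Omega> = tau_minus \<Phi> \<Omega>"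
  by (simp add: tau_plus_def tau_minus_def fun_eq_iff)

lemma tau_minus_reverse: "tau_minus (\<lambda>x t. \<Phi> x (- t)) \<Omega> = tau_plus \<Phi> \<Omega>"
  by (simp add: tau_plus_def tau_minus_def fun_eq_iff)

lemma flow_in_if_less_tau_minus:
  assumes "0 < s" "ereal s < tau_minus \<Phi> \<Omega> x"
  shows "\<Phi> x (- s) \<in> \<Omega>"
  using flow_in_if_less_tau_plus[of s "\<lambda>x t. \<Phi> x (- t)"] assms by (simp add: tau_plus_reverse)

lemma enters_at_reverse: "enters_at (\<lambda>x t. \<Phi> x (- t)) \<Omega> = exits_at \<Phi> \<Omega>"
  by (simp add: enters_at_def exits_at_def tau_minus_reverse fun_eq_iff)

lemma Gamma_minus_reverse: "Gamma_minus (\<lambda>x t. \<Phi> x (- t)) \<Omega> = Gamma_plus \<Phi> \<Omega>"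
  by (simp add: Gamma_minus_def Gamma_plus_def enters_at_reverse)

lemma length_from_reverse: "length_from (\<lambda>x t. \<Phi> x (- t)) \<Omega> = length_to \<Phi> \<Omega>"
  by (simp add: length_from_def length_to_def enters_at_reverse tau_plus_reverse
      tau_minus_reverse Let_def add.commute fun_eq_iff)

lemma tau_plus_nonneg: "0 \<le> tau_plus \<Phi> \<Omega> x"
  unfolding tau_plus_def by (intro INF_greatest) auto

lemma tau_minus_nonneg: "0 \<le> tau_minus \<Phi> \<Omega> x"
  unfolding tau_minus_def by (intro INF_greatest) auto

text \<open>
  The length is computed from a chosen point \<open>x\<close> of the curve, which lies at a time \<open>a > 0\<close> after \<open>y\<close>:
  up to time \<open>a\<close> the curve from \<open>y\<close> is the past of \<open>x\<close>, afterwards it is the future of \<open>x\<close>.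
\<close>

lemma incoming_curve:
  fixes F :: "'a::euclidean_space \<Rightarrow> 'a"
  assumes lip: "L-lipschitz_on UNIV F" and flow: "is_flow_of F \<Phi>"
    and "open \<Omega>" and y: "y \<in> Gamma_minus \<Phi> \<Omega>"
  shows length_from_pos: "0 < length_from \<Phi> \<Omega> y"
    and flow_in_if_less_length_from:
      "\<And>s. 0 < s \<Longrightarrow> ereal s < length_from \<Phi> \<Omega> y \<Longrightarrow> \<Phi> y s \<in> \<Omega>"
proof -
  define x where "x = (SOME x. enters_at \<Phi> \<Omega> x y)"
  have "enters_at \<Phi> \<Omega> x y"
    unfolding x_def using y by (auto simp: Gamma_minus_def intro: someI)
  then obtain a where x: "x \<in> \<Omega>" and a: "tau_minus \<Phi> \<Omega> x = ereal a" and yx: "y = \<Phi> x (- a)"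
    using tau_minus_nonneg[of \<Phi> \<Omega> x] unfolding enters_at_def
    by (cases "tau_minus \<Phi> \<Omega> x") auto
  have len: "length_from \<Phi> \<Omega> y = ereal a + tau_plus \<Phi> \<Omega> x"
    by (simp add: length_from_def x_def[symmetric] a)
  \<comment> \<open>A point of the frontier is not in the open set, so it differs from \<open>x\<close>.\<close>
  have "y \<notin> \<Omega>"
    using y \<open>open \<Omega>\<close> by (auto simp: Gamma_minus_def frontier_def interior_open)
  have "a \<noteq> 0"
    using \<open>y \<notin> \<Omega>\<close> x yx flow by (auto simp: is_flow_of_def)
  then have "0 < a" using tau_minus_nonneg[of \<Phi> \<Omega> x] a by simp
  then show "0 < length_from \<Phi> \<Omega> y"
    using tau_plus_nonneg[of \<Phi> \<Omega> x] unfolding len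
    by (cases "tau_plus \<Phi> \<Omega> x") auto
  fix s assume s: "0 < s" "ereal s < length_from \<Phi> \<Omega> y"
  have ys: "\<Phi> y s = \<Phi> x (s - a)"
    unfolding yx by (simp add: flow_add[OF lip flow])
  consider "s < a" | "s = a" | "a < s" by linarith
  then show "\<Phi> y s \<in> \<Omega>"
  proof cases
    case 1
    then show ?thesis
      using flow_in_if_less_tau_minus[of "a - s" \<Phi> \<Omega> x] s(1) a unfolding ys by simp
  next
    case 2
    then show ?thesis using x flow unfolding ys by (simp add: is_flow_of_def)
  next
    case 3
    then have "ereal (s - a) < tau_plus \<Phi> \<Omega> x"
      using s(2) unfolding len by (cases "tau_plus \<Phi> \<Omega> x") auto
    then show ?thesis using flow_in_if_less_tau_plus[of "s - a"] 3 unfolding ys by simp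
  qed
qed

text \<open>
  Seen from the point reached at time \<open>s\<close>, the curve stays in \<open>\<Omega>\<close> all the way back to \<open>y\<close> and for a
  while afterwards. This is what makes the identity at that one point speak about the
  whole piece of the curve between \<open>y\<close> and the point.
\<close>

lemma tau_on_incoming_curve:
  fixes F :: "'a::euclidean_space \<Rightarrow> 'a"
  assumes lip: "L-lipschitz_on UNIV F" and flow: "is_flow_of F \<Phi>"
    and "open \<Omega>" and y: "y \<in> Gamma_minus \<Phi> \<Omega>"
    and s: "0 < s" "ereal s < length_from \<Phi> \<Omega> y"
  shows "ereal s \<le> tau_minus \<Phi> \<Omega> (\<Phi> y s)" "0 < tau_plus \<Phi> \<Omega> (\<Phi> y s)"
proof -
  note inside = flow_in_if_less_length_from[OF lip flow \<open>open \<Omega>\<close> y]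
  have add: "\<Phi> (\<Phi> y s) r = \<Phi> y (s + r)" for r
    by (rule flow_add[OF lip flow])
  have "s \<le> r" if "0 < r" "\<Phi> (\<Phi> y s) (- r) \<notin> \<Omega>" for r
  proof (rule ccontr)
    assume "\<not> s \<le> r"
    then have "\<Phi> y (s - r) \<in> \<Omega>"
      using s that(1) by (intro inside) (auto intro: le_less_trans[of _ "ereal s"])
    with that(2) show False by (simp add: add)
  qed
  then show "ereal s \<le> tau_minus \<Phi> \<Omega> (\<Phi> y s)"
    unfolding tau_minus_def by (intro INF_greatest) auto
  obtain b where b: "ereal s < ereal b" "ereal b < length_from \<Phi> \<Omega> y"
    using ereal_dense2[OF s(2)] by blast
  have "b - s \<le> r" if "0 < r" "\<Phi> (\<Phi> y s) r \<notin> \<Omega>" for r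
  proof (rule ccontr)
    assume "\<not> b - s \<le> r"
    then have "ereal (s + r) < length_from \<Phi> \<Omega> y"
      by (intro less_trans[OF _ b(2)]) simp
    then have "\<Phi> y (s + r) \<in> \<Omega>"
      using s that(1) by (intro inside) auto
    with that(2) show False by (simp add: add)
  qed
  then have "ereal (b - s) \<le> tau_plus \<Phi> \<Omega> (\<Phi> y s)"
    unfolding tau_plus_def by (intro INF_greatest) auto
  moreover have "0 < ereal (b - s)" using b(1) by simp
  ultimately show "0 < tau_plus \<Phi> \<Omega> (\<Phi> y s)" by (rule less_le_trans[rotated])
qed

section \<open>Borel representatives for a Radon measure\<close>

lemma radon_measure_sets_borel:
  assumes "radon_measure \<mu>"
  shows "sets borel \<subseteq> sets \<mu>" "space \<mu> = UNIV"
  using assms unfolding radon_measure_def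
  by (auto dest: sets_eq_imp_space_eq intro: sets_completionI_sets)

lemma radon_measure_sigma_finite:
  fixes \<mu> :: "'a::euclidean_space measure"
  assumes "radon_measure \<mu>"
  shows "sigma_finite_measure \<mu>"
proof
  let ?A = "range (\<lambda>n. cball (0::'a) (real n))"
  show "\<exists>A. countable A \<and> A \<subseteq> sets \<mu> \<and> \<Union> A = space \<mu> \<and> (\<forall>a\<in>A. emeasure \<mu> a \<noteq> \<infinity>)"
  proof (rule exI[of _ ?A], safe)
    fix n
    show "cball 0 (real n) \<in> sets \<mu>"
      using radon_measure_sets_borel(1)[OF assms] borel_closed[OF closed_cball] by blast
    show False if "emeasure \<mu> (cball 0 (real n)) = \<infinity>"
      using assms compact_cball[of "0::'a" "real n"] that
      unfolding radon_measure_def by (metis less_irrefl)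
  next
    fix x :: 'a
    obtain n where "norm x \<le> real n" using real_arch_simple by blast
    then show "x \<in> \<Union> ?A" by auto
  qed (simp_all add: radon_measure_sets_borel(2)[OF assms])
qed

text \<open>
  The boundary identities accept Borel test functions only, while the measure may be a completion.
  This lemma and the next one replace null sets and measurable functions by Borel ones.
\<close>

lemma radon_measure_AE_borel:
  assumes rad: "radon_measure \<mu>" and AE: "AE x in \<mu>. P x"
  obtains N where "N \<in> sets borel" "emeasure \<mu> N = 0" "\<And>x. x \<notin> N \<Longrightarrow> P x"
proof -
  obtain \<nu> where \<nu>: "sets \<nu> = sets borel" "\<mu> = \<nu> \<or> \<mu> = completion \<nu>"
    using rad unfolding radon_measure_def by blast
  have "AE x in \<nu>. P x" using \<nu>(2) AE by (auto simp: AE_completion_iff)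
  then obtain N where N: "{x \<in> space \<nu>. \<not> P x} \<subseteq> N" "emeasure \<nu> N = 0" "N \<in> sets \<nu>"
    by (rule AE_E)
  have "emeasure \<mu> N = 0" using \<nu>(2) N by auto
  moreover have "space \<nu> = UNIV" using \<nu>(1) by (auto dest: sets_eq_imp_space_eq)
  ultimately show ?thesis using that[of N] N \<nu>(1) by blast
qed

lemma radon_measure_borel_representative:
  fixes h :: "'a::topological_space \<Rightarrow> real"
  assumes rad: "radon_measure \<mu>" and h: "h \<in> borel_measurable \<mu>"
  obtains h' where "h' \<in> borel_measurable borel" "AE x in \<mu>. h x = h' x"
proof -
  obtain \<nu> where \<nu>: "sets \<nu> = sets borel" "\<mu> = \<nu> \<or> \<mu> = completion \<nu>"
    using rad unfolding radon_measure_def by blast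
  have [simp]: "borel_measurable \<nu> = (borel_measurable borel :: ('a \<Rightarrow> real) set)"
    using \<nu>(1) by (auto cong: measurable_cong_sets)
  from \<nu>(2) show ?thesis
  proof
    assume "\<mu> = \<nu>"
    then show ?thesis using h that[of h] by simp
  next
    assume \<mu>: "\<mu> = completion \<nu>"
    then obtain h' where "h' \<in> borel_measurable \<nu>" "AE x in \<nu>. h x = h' x"
      using completion_ex_borel_measurable_real h by blast
    moreover from this have "AE x in \<mu>. h x = h' x" unfolding \<mu> by (intro AE_completion)
    ultimately show ?thesis using that[of h'] by simp
  qed
qed

section \<open>Test functions that do not depend on time\<close>

text \<open>
  With \<open>T = 1\<close>, the curves in the boundary identities are followed for a time up to \<open>1 - t\<close> or \<open>t\<close>,
  where \<open>t\<close> is known to be good only almost everywhere. The cut-off \<open>1/2\<close> makes the segment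
  independent of \<open>t\<close>: one good \<open>t\<close> in the half of the unit interval where this bound is at least
  \<open>1/2\<close> is enough.
\<close>

definition initial_segment :: "ereal \<Rightarrow> real set" where
  "initial_segment a = {s. 0 < s \<and> ereal s < min a (ereal (1/2))}"

text \<open>
  What the limit argument needs to know about a boundary measure \<open>\<nu>\<close>: integrability over \<open>\<Omega>\<close>, and
  vanishing almost everywhere in \<open>\<Omega>\<close>, are inherited by the initial segments of
  \<open>\<nu>\<close>-almost all curves.
\<close>

definition controls_entrance ::
    "'a::topological_space measure \<Rightarrow> 'a set \<Rightarrow> 'a measure \<Rightarrow> ('a \<Rightarrow> real \<Rightarrow> 'a) \<Rightarrow> ('a \<Rightarrow> ereal) \<Rightarrow> bool"
where
  "controls_entrance \<mu> \<Omega> \<nu> \<Phi> len \<longleftrightarrow>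
     (\<forall>\<phi>::'a \<Rightarrow> real. \<phi> \<in> borel_measurable borel \<longrightarrow> (\<forall>x. 0 \<le> \<phi> x) \<longrightarrow>
       set_integrable \<mu> \<Omega> \<phi> \<longrightarrow>
       (AE y in \<nu>. set_integrable lborel (initial_segment (len y)) (\<lambda>s. \<phi> (\<Phi> y s))) \<and>
       ((LINT x:\<Omega>|\<mu>. \<phi> x) = 0 \<longrightarrow>
         (AE y in \<nu>. AE s in lborel. s \<in> initial_segment (len y) \<longrightarrow> \<phi> (\<Phi> y s) = 0)))"

lemma controls_entranceD:
  fixes \<phi> :: "'a::topological_space \<Rightarrow> real"
  assumes "controls_entrance \<mu> \<Omega> \<nu> \<Phi> len"
    and "\<phi> \<in> borel_measurable borel" "\<forall>x. 0 \<le> \<phi> x" "set_integrable \<mu> \<Omega> \<phi>"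
  shows "AE y in \<nu>. set_integrable lborel (initial_segment (len y)) (\<lambda>s. \<phi> (\<Phi> y s))"
    and "(LINT x:\<Omega>|\<mu>. \<phi> x) = 0 \<Longrightarrow>
      AE y in \<nu>. AE s in lborel. s \<in> initial_segment (len y) \<longrightarrow> \<phi> (\<Phi> y s) = 0"
  using assms unfolding controls_entrance_def by blast+

text \<open>
  This makes integrable functions of the position admissible as test functions; by Fubini's theorem the
  time interval, of length \<open>1\<close>, contributes the factor \<open>1\<close>.
\<close>

lemma set_integrable_cylinder:
  fixes \<phi> :: "'a \<Rightarrow> real"
  assumes sf: "sigma_finite_measure \<mu>" and \<phi>: "set_integrable \<mu> \<Omega> \<phi>"
  shows "set_integrable (\<mu> \<Otimes>\<^sub>M lborel) (\<Omega> \<times> {0<..<1::real}) (\<lambda>z. \<phi> (fst z))"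
    and "(LINT z:\<Omega> \<times> {0<..<1::real}|\<mu> \<Otimes>\<^sub>M lborel. \<phi> (fst z)) = (LINT x:\<Omega>|\<mu>. \<phi> x)"
proof -
  interpret \<mu>: sigma_finite_measure \<mu> by fact
  interpret pair_sigma_finite \<mu> lborel ..
  define k where "k = (\<lambda>x. indicator \<Omega> x *\<^sub>R \<phi> x)"
  have k[measurable]: "integrable \<mu> k" "k \<in> borel_measurable \<mu>"
    using \<phi> by (auto simp: k_def set_integrable_def)
  let ?f = "\<lambda>z. k (fst z) * indicator {0<..<1::real} (snd z)"
  have f: "(\<lambda>z. indicator (\<Omega> \<times> {0<..<1::real}) z *\<^sub>R \<phi> (fst z)) = ?f"
    by (auto simp: k_def indicator_def fun_eq_iff)
  have int: "integrable (\<mu> \<Otimes>\<^sub>M lborel) ?f"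
  proof (rule Fubini_integrable)
    show "?f \<in> borel_measurable (\<mu> \<Otimes>\<^sub>M lborel)" by measurable
    show "integrable \<mu> (\<lambda>x. \<integral>t. norm (?f (x, t)) \<partial>lborel)"
      using k(1) by (simp add: abs_mult)
    show "AE x in \<mu>. integrable lborel (\<lambda>t. ?f (x, t))"
      by (simp add: integrable_real_indicator)
  qed
  then show "set_integrable (\<mu> \<Otimes>\<^sub>M lborel) (\<Omega> \<times> {0<..<1::real}) (\<lambda>z. \<phi> (fst z))"
    unfolding set_integrable_def f .
  have "integral\<^sup>L (\<mu> \<Otimes>\<^sub>M lborel) ?f = (\<integral>x. k x \<partial>\<mu>)"
    by (simp add: integral_fst'[OF int, symmetric])
  then show "(LINT z:\<Omega> \<times> {0<..<1::real}|\<mu> \<Otimes>\<^sub>M lborel. \<phi> (fst z)) = (LINT x:\<Omega>|\<mu>. \<phi> x)"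
    unfolding set_lebesgue_integral_def f k_def .
qed

lemma borel_initial_interval: "{s::real. 0 < s \<and> ereal s < a} \<in> sets borel"
  by measurable

lemma integrable_lebesgue_upto:
  "integrable (lebesgue_upto a) h \<longleftrightarrow> set_integrable lborel {s. 0 < s \<and> ereal s < a} h"
  for h :: "real \<Rightarrow> real"
  unfolding lebesgue_upto_def set_integrable_def
  by (rule integrable_restrict_space) (simp add: borel_initial_interval)

lemma AE_lebesgue_upto:
  "(AE s in lebesgue_upto a. P s) \<longleftrightarrow> (AE s in lborel. 0 < s \<and> ereal s < a \<longrightarrow> P s)"
  unfolding lebesgue_upto_def
  by (subst AE_restrict_space_iff) (simp_all add: borel_initial_interval)

lemma AE_lborel_obtain_in_interval:
  fixes a b :: real
  assumes "AE t in lborel. t \<in> {a<..<b} \<longrightarrow> P t" "a < b"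
  obtains t where "a < t" "t < b" "P t"
proof (rule ccontr)
  assume "\<not> thesis"
  with that have "\<not> P t" if "t \<in> {a<..<b}" for t using that by auto
  with assms(1) have "AE t in lborel. t \<notin> {a<..<b}" by auto
  then have "emeasure lborel {a<..<b} = 0" 
    by (subst (asm) AE_iff_measurable[of "{a<..<b}"]) auto
  with \<open>a < b\<close> show False by simp
qed

lemma iterated_integral_nonneg:
  assumes "\<And>x s. 0 \<le> h x s"
  shows "0 \<le> iterated_integral M K h"
  unfolding iterated_integral_def by (intro integral_nonneg_AE AE_I2 assms)

text \<open>
  The common core of the incoming and the outgoing identity for a time-independent test function \<open>\<phi> \<ge> 0\<close>.
  The curves are followed up to time \<open>c t\<close>, and \<open>J\<close> stands for the contribution of the points
  already in \<open>\<Omega>\<close> at time \<open>0\<close> (incoming case) or still in \<open>\<Omega>\<close> at time \<open>1\<close> (outgoing case). If \<open>tot = 0\<close>, the nonnegative integrals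
  on the right vanish, and an iterated integral of a nonnegative function vanishes only if
  almost all inner integrals do.
\<close>

lemma boundary_identity_controls:
  fixes \<phi> :: "'a::topological_space \<Rightarrow> real" and J :: real
  assumes pos: "\<And>x. 0 \<le> \<phi> x"
    and ae: "AE t in lebesgue_upto (ereal 1).
        iterated_integrable \<nu> (\<lambda>y. lebesgue_upto (min (len y) (ereal (c t)))) (\<lambda>y s. \<phi> (\<Phi> y s))"
    and int: "integrable (lebesgue_upto (ereal 1))
        (\<lambda>t. iterated_integral \<nu> (\<lambda>y. lebesgue_upto (min (len y) (ereal (c t)))) (\<lambda>y s. \<phi> (\<Phi> y s)))"
    and eq: "tot =
        (\<integral>t. iterated_integral \<nu> (\<lambda>y. lebesgue_upto (min (len y) (ereal (c t)))) (\<lambda>y s. \<phi> (\<Phi> y s))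
           \<partial>lebesgue_upto (ereal 1)) + J" and "0 \<le> J"
    and c: "0 \<le> a" "a < b" "b \<le> 1" "\<And>t. a < t \<Longrightarrow> t < b \<Longrightarrow> 1/2 \<le> c t"
  shows "AE y in \<nu>. set_integrable lborel (initial_segment (len y)) (\<lambda>s. \<phi> (\<Phi> y s))"
    and "tot = 0 \<Longrightarrow>
      AE y in \<nu>. AE s in lborel. s \<in> initial_segment (len y) \<longrightarrow> \<phi> (\<Phi> y s) = 0"
proof -
  let ?K = "\<lambda>t y. lebesgue_upto (min (len y) (ereal (c t)))"
  let ?I = "\<lambda>t. iterated_integral \<nu> (?K t) (\<lambda>y s. \<phi> (\<Phi> y s))"
  have sub: "initial_segment (len y) \<subseteq> {s. 0 < s \<and> ereal s < min (len y) (ereal (c t))}"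
    if "a < t" "t < b" for t y
    using c(4)[OF that] by (auto simp: initial_segment_def)
  have ae': "AE t in lborel. t \<in> {a<..<b} \<longrightarrow> iterated_integrable \<nu> (?K t) (\<lambda>y s. \<phi> (\<Phi> y s))"
    using ae unfolding AE_lebesgue_upto by eventually_elim (use c in auto)
  obtain t where t: "a < t" "t < b" "iterated_integrable \<nu> (?K t) (\<lambda>y s. \<phi> (\<Phi> y s))"
    using AE_lborel_obtain_in_interval[OF ae' \<open>a < b\<close>] .
  have "AE y in \<nu>. integrable (?K t y) (\<lambda>s. \<phi> (\<Phi> y s))"
    using t(3) by (simp add: iterated_integrable_def)
  then show "AE y in \<nu>. set_integrable lborel (initial_segment (len y)) (\<lambda>s. \<phi> (\<Phi> y s))"
  proof eventually_elim
    case (elim y)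
    then show ?case
      unfolding integrable_lebesgue_upto
      by (rule set_integrable_subset)
        (use sub[OF t(1,2)] borel_initial_interval in \<open>auto simp: initial_segment_def\<close>)
  qed
  assume "tot = 0"
  have I_nonneg: "0 \<le> ?I t" for t
    by (rule iterated_integral_nonneg) (rule pos)
  then have "(\<integral>t. ?I t \<partial>lebesgue_upto (ereal 1)) = 0"
    using eq \<open>tot = 0\<close> \<open>0 \<le> J\<close> integral_nonneg_AE[of ?I "lebesgue_upto (ereal 1)", OF AE_I2, OF I_nonneg]
    by linarith
  then have "AE t in lebesgue_upto (ereal 1). ?I t = 0"
    using integral_nonneg_eq_0_iff_AE[OF int] I_nonneg by auto
  with ae have ae0: "AE t in lborel. t \<in> {a<..<b} \<longrightarrow>
      iterated_integrable \<nu> (?K t) (\<lambda>y s. \<phi> (\<Phi> y s)) \<and> ?I t = 0"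
    unfolding AE_lebesgue_upto by eventually_elim (use c in auto)
  obtain t where t: "a < t" "t < b"
    and It: "iterated_integrable \<nu> (?K t) (\<lambda>y s. \<phi> (\<Phi> y s)) \<and> ?I t = 0"
    using AE_lborel_obtain_in_interval[OF ae0 \<open>a < b\<close>] .
  have inner: "AE y in \<nu>. integrable (?K t y) (\<lambda>s. \<phi> (\<Phi> y s))"
    and outer: "integrable \<nu> (\<lambda>y. \<integral>s. \<phi> (\<Phi> y s) \<partial>?K t y)"
    using It unfolding iterated_integrable_def by simp_all
  have "AE y in \<nu>. 0 \<le> (\<integral>s. \<phi> (\<Phi> y s) \<partial>?K t y)"
    by (intro AE_I2 integral_nonneg_AE pos)
  then have "AE y in \<nu>. (\<integral>s. \<phi> (\<Phi> y s) \<partial>?K t y) = 0"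
    using It integral_nonneg_eq_0_iff_AE[OF outer] unfolding iterated_integral_def by blast
  with inner show "AE y in \<nu>. AE s in lborel. s \<in> initial_segment (len y) \<longrightarrow> \<phi> (\<Phi> y s) = 0"
  proof eventually_elim
    case (elim y)
    then have "AE s in ?K t y. \<phi> (\<Phi> y s) = 0"
      using integral_nonneg_eq_0_iff_AE[OF elim(1)] pos by auto
    then show ?case
      unfolding AE_lebesgue_upto by eventually_elim (use sub[OF t(1,2), of y] in blast)
  qed
qed

text \<open>
  Here the curves are followed up to time \<open>1 - t\<close>, which is at least \<open>1/2\<close> for \<open>t < 1/2\<close>.
\<close>

lemma incoming_measure_controls_entrance:
  fixes \<mu> :: "'a::euclidean_space measure"
  assumes "incoming_boundary_measure \<mu> \<Phi> \<Omega> \<nu>" and "sigma_finite_measure \<mu>"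
  shows "controls_entrance \<mu> \<Omega> \<nu> \<Phi> (length_from \<Phi> \<Omega>)"
  unfolding controls_entrance_def
proof (intro allI impI)
  fix \<phi> :: "'a \<Rightarrow> real"
  assume \<phi>: "\<phi> \<in> borel_measurable borel" "\<forall>x. 0 \<le> \<phi> x" "set_integrable \<mu> \<Omega> \<phi>"
  have \<phi>m: "(\<lambda>z::'a \<times> real. \<phi> (fst z)) \<in> borel_measurable borel"
    using \<phi>(1) unfolding borel_prod[symmetric] by measurable
  note cylinder = set_integrable_cylinder[OF assms(2) \<phi>(3)]
  note facts = assms(1)[unfolded incoming_boundary_measure_def Let_def, THEN conjunct2, rule_format,
      OF zero_less_one \<phi>m cylinder(1), unfolded fst_conv cylinder(2)]
  show "(AE y in \<nu>. set_integrable lborel (initial_segment (length_from \<Phi> \<Omega> y)) (\<lambda>s. \<phi> (\<Phi> y s))) \<and>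
     ((LINT x:\<Omega>|\<mu>. \<phi> x) = 0 \<longrightarrow>
      (AE y in \<nu>. AE s in lborel. s \<in> initial_segment (length_from \<Phi> \<Omega> y) \<longrightarrow> \<phi> (\<Phi> y s) = 0))"
    using boundary_identity_controls[of \<phi> \<nu> "length_from \<Phi> \<Omega>" "\<lambda>t. 1 - t" \<Phi>,
        OF _ facts[THEN conjunct1] facts[THEN conjunct2, THEN conjunct1]
          facts[THEN conjunct2, THEN conjunct2, THEN conjunct2] iterated_integral_nonneg,
        of 0 "1/2"] \<phi>(2)
    by auto
qed

text \<open>
  Here the curves are followed backwards up to time \<open>t\<close>, which is at least \<open>1/2\<close> for \<open>t > 1/2\<close>.
\<close>

lemma outgoing_measure_controls_entrance:
  fixes \<mu> :: "'a::euclidean_space measure"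
  assumes "outgoing_boundary_measure \<mu> \<Phi> \<Omega> \<nu>" and "sigma_finite_measure \<mu>"
  shows "controls_entrance \<mu> \<Omega> \<nu> (\<lambda>x t. \<Phi> x (- t)) (length_to \<Phi> \<Omega>)"
  unfolding controls_entrance_def
proof (intro allI impI)
  fix \<phi> :: "'a \<Rightarrow> real"
  assume \<phi>: "\<phi> \<in> borel_measurable borel" "\<forall>x. 0 \<le> \<phi> x" "set_integrable \<mu> \<Omega> \<phi>"
  have \<phi>m: "(\<lambda>z::'a \<times> real. \<phi> (fst z)) \<in> borel_measurable borel"
    using \<phi>(1) unfolding borel_prod[symmetric] by measurable
  note cylinder = set_integrable_cylinder[OF assms(2) \<phi>(3)]
  note facts = assms(1)[unfolded outgoing_boundary_measure_def Let_def, THEN conjunct2, rule_format,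
      OF zero_less_one \<phi>m cylinder(1), unfolded fst_conv cylinder(2)]
  show "(AE y in \<nu>. set_integrable lborel (initial_segment (length_to \<Phi> \<Omega> y)) (\<lambda>s. \<phi> (\<Phi> y (- s)))) \<and>
     ((LINT x:\<Omega>|\<mu>. \<phi> x) = 0 \<longrightarrow>
      (AE y in \<nu>. AE s in lborel. s \<in> initial_segment (length_to \<Phi> \<Omega> y) \<longrightarrow> \<phi> (\<Phi> y (- s)) = 0))"
    using boundary_identity_controls[of \<phi> \<nu> "length_to \<Phi> \<Omega>" "\<lambda>t. t" "\<lambda>x t. \<Phi> x (- t)",
        OF _ facts[THEN conjunct1] facts[THEN conjunct2, THEN conjunct1]
          facts[THEN conjunct2, THEN conjunct2, THEN conjunct2] iterated_integral_nonneg,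
        of "1/2" 1] \<phi>(2)
    by auto
qed

section \<open>The limit at the start of an integral curve\<close>

text \<open>
  The limit at \<open>0\<close> exists because the indefinite integral of an integrable function is continuous
  up to the end of the interval. The integrand \<open>q\<close> is only almost everywhere equal to a Borel
  function, hence the detour over Lebesgue measure.
\<close>

lemma right_limit_of_primitive:
  fixes u q q' :: "real \<Rightarrow> real"
  assumes q': "set_integrable lborel {0<..<c} q'"
    and ae: "AE s in lborel. s \<in> {0<..<c} \<longrightarrow> q s = q' s"
    and s0: "0 < s0" "s0 < c"
    and u: "\<And>t. 0 < t \<Longrightarrow> t < s0 \<Longrightarrow> u t - u s0 = (LINT r:{t..s0}|lebesgue. q r)"
  shows "\<exists>l. (u \<longlongrightarrow> l) (at_right 0)"
proof -
  have "(\<lambda>x. indicator {0<..<c} x *\<^sub>R q' x) \<in> borel_measurable lborel"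
    using q' unfolding set_integrable_def by (rule borel_measurable_integrable)
  then have abs_q': "q' absolutely_integrable_on {0<..<c}"
    using q' unfolding set_integrable_def by (simp add: integrable_completion)
  obtain N where N: "N \<in> null_sets lborel" "{s. \<not> (s \<in> {0<..<c} \<longrightarrow> q s = q' s)} \<subseteq> N"
    using ae unfolding eventually_ae_filter by auto
  have "negligible N"
    using N(1) by (simp add: negligible_iff_null_sets null_sets_completionI)
  then have q: "q absolutely_integrable_on {0<..<c}"
    by (rule absolutely_integrable_spike[OF abs_q']) (use N(2) in blast)
  have sub: "q absolutely_integrable_on {t..s0}" if "0 < t" for t
    using q by (rule set_integrable_subset) (use that s0 in auto)
  have "q absolutely_integrable_on {0<..s0}"
    using q by (rule set_integrable_subset) (use s0 in auto)
  then have "q integrable_on {0<..s0}"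
    by (rule set_lebesgue_integral_eq_integral)
  then have "q integrable_on {0..s0}"
    by (rule integrable_spike_set) (auto intro: negligible_subset[of "{0}"])
  then have "continuous_on {0..s0} (\<lambda>t. integral {t..s0} q)"
    by (rule indefinite_integral_continuous_1')
  then have "((\<lambda>t. integral {t..s0} q) \<longlongrightarrow> integral {0..s0} q) (at 0 within {0..s0})"
    using s0(1) by (simp add: continuous_on_def)
  then have "((\<lambda>t. u s0 + integral {t..s0} q) \<longlongrightarrow> u s0 + integral {0..s0} q) (at_right 0)"
    using s0(1) by (intro tendsto_intros) (simp add: at_within_Icc_at_right)
  moreover have "\<forall>\<^sub>F t in at_right 0. u s0 + integral {t..s0} q = u t"
    using eventually_at_right_less[of "0::real"] eventually_at_right_real[OF s0(1)]
  proof eventually_elim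
    case (elim t)
    then show ?case
      using u[of t] set_lebesgue_integral_eq_integral(2)[OF sub[of t]] by simp
  qed
  ultimately have "(u \<longlongrightarrow> u s0 + integral {0..s0} q) (at_right 0)"
    by (rule Lim_transform_eventually)
  then show ?thesis ..
qed

text \<open>
  For \<open>\<nu>\<close>-almost every \<open>y\<close> the representative \<open>g'\<close> is integrable along the curve near \<open>y\<close> and the
  curve avoids the exceptional set \<open>N\<close> at almost every time; for each such \<open>y\<close> the preceding lemma applies.
\<close>

lemma right_limit_at_entrance:
  fixes \<mu> \<nu> :: "'a::euclidean_space measure" and g fs :: "'a \<Rightarrow> real"
  assumes rad: "radon_measure \<mu>" and lip: "L-lipschitz_on UNIV F" and flow: "is_flow_of F \<Phi>"
    and "open \<Omega>" and \<nu>: "space \<nu> = Gamma_minus \<Phi> \<Omega>"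
    and ctrl: "controls_entrance \<mu> \<Omega> \<nu> \<Phi> (length_from \<Phi> \<Omega>)"
    and g: "set_integrable \<mu> \<Omega> g"
    and primitive: "AE x in \<mu>. x \<in> \<Omega> \<longrightarrow>
           (\<forall>t1 t2. - tau_minus \<Phi> \<Omega> x < ereal t1 \<and> t1 \<le> t2 \<and> ereal t2 < tau_plus \<Phi> \<Omega> x \<longrightarrow>
              fs (\<Phi> x t1) - fs (\<Phi> x t2) = (LINT s:{t1..t2}|lebesgue. g (\<Phi> x s)))"
  shows "AE y in \<nu>. \<exists>l. ((\<lambda>t. fs (\<Phi> y t)) \<longlongrightarrow> l) (at_right 0)"
proof -
  have g_meas: "(\<lambda>x. indicator \<Omega> x *\<^sub>R g x) \<in> borel_measurable \<mu>"
    using g unfolding set_integrable_def by (rule borel_measurable_integrable)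
  then obtain g' where g': "g' \<in> borel_measurable borel"
    and gg': "AE x in \<mu>. indicator \<Omega> x *\<^sub>R g x = g' x"
    using radon_measure_borel_representative[OF rad] by blast
  \<comment> \<open>At a good point the primitive identity holds and the Borel representative has the right value.\<close>
  define good where "good = (\<lambda>x. indicator \<Omega> x *\<^sub>R g x = g' x \<and> (x \<in> \<Omega> \<longrightarrow>
           (\<forall>t1 t2. - tau_minus \<Phi> \<Omega> x < ereal t1 \<and> t1 \<le> t2 \<and> ereal t2 < tau_plus \<Phi> \<Omega> x \<longrightarrow>
              fs (\<Phi> x t1) - fs (\<Phi> x t2) = (LINT s:{t1..t2}|lebesgue. g (\<Phi> x s)))))"
  have "AE x in \<mu>. good x" using gg' primitive unfolding good_def by (rule AE_conjI)
  then obtain N where N: "N \<in> sets borel" "emeasure \<mu> N = 0" "\<And>x. x \<notin> N \<Longrightarrow> good x"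
    using radon_measure_AE_borel[OF rad] by blast
  have borel_\<mu>: "h \<in> borel_measurable \<mu>" if "h \<in> borel_measurable borel" for h :: "'a \<Rightarrow> real"
    using that radon_measure_sets_borel[OF rad]
    unfolding measurable_def by auto
  have "integrable \<mu> g'"
    using g integrable_cong_AE[OF g_meas borel_\<mu>[OF g'] gg'] unfolding set_integrable_def by blast
  then have "set_integrable \<mu> \<Omega> (\<lambda>x. \<bar>g' x\<bar>)"
    using radon_measure_sets_borel[OF rad] \<open>open \<Omega>\<close> unfolding set_integrable_def
    by (intro integrable_mult_indicator integrable_abs) auto
  then have seg_g': "AE y in \<nu>. set_integrable lborel (initial_segment (length_from \<Phi> \<Omega> y))
      (\<lambda>s. \<bar>g' (\<Phi> y s)\<bar>)"
    by (intro controls_entranceD(1)[OF ctrl] borel_measurable_abs g') auto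
  have N\<mu>: "N \<in> null_sets \<mu>"
    using N radon_measure_sets_borel[OF rad] by auto
  have "AE x in \<mu>. indicator \<Omega> x *\<^sub>R indicat_real N x = 0"
    using AE_not_in[OF N\<mu>] by eventually_elim simp
  moreover have "(\<lambda>x. indicator \<Omega> x *\<^sub>R indicat_real N x) \<in> borel_measurable \<mu>"
    using N(1) \<open>open \<Omega>\<close>
    by (intro borel_\<mu> borel_measurable_scaleR borel_measurable_indicator) auto
  ultimately have "set_integrable \<mu> \<Omega> (indicat_real N)" "(LINT x:\<Omega>|\<mu>. indicat_real N x) = 0"
    unfolding set_integrable_def set_lebesgue_integral_def
    using integrable_cong_AE[of "\<lambda>x. indicator \<Omega> x *\<^sub>R indicat_real N x" \<mu> "\<lambda>_. 0"]
    by (auto intro: integral_eq_zero_AE)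
  then have "AE y in \<nu>. AE s in lborel. s \<in> initial_segment (length_from \<Phi> \<Omega> y) \<longrightarrow>
      indicat_real N (\<Phi> y s) = 0"
    by (intro controls_entranceD(2)[OF ctrl] borel_measurable_indicator N(1)) auto
  then have seg_N: "AE y in \<nu>. AE s in lborel. s \<in> initial_segment (length_from \<Phi> \<Omega> y) \<longrightarrow>
      \<Phi> y s \<notin> N"
    by (simp add: indicator_eq_0_iff)
  from seg_g' seg_N AE_space show ?thesis
  proof eventually_elim
    case (elim y)
    let ?len = "length_from \<Phi> \<Omega> y"
    have y: "y \<in> Gamma_minus \<Phi> \<Omega>" using elim(3) \<nu> by simp
    note inside = flow_in_if_less_length_from[OF lip flow \<open>open \<Omega>\<close> y]
    have "0 < min ?len (ereal (1/2))"
      using length_from_pos[OF lip flow \<open>open \<Omega>\<close> y] by simp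
    then obtain c where "0 < ereal c" and c: "ereal c < min ?len (ereal (1/2))"
      using ereal_dense2 by blast
    then have "0 < c" by simp
    have seg: "{0<..<c} \<subseteq> initial_segment ?len"
    proof
      fix s assume "s \<in> {0<..<c}"
      then have "0 < s" "ereal s < ereal c" by auto
      then show "s \<in> initial_segment ?len"
        using less_trans[OF \<open>ereal s < ereal c\<close> c] unfolding initial_segment_def by blast
    qed
    have in_\<Omega>: "\<Phi> y s \<in> \<Omega>" "ereal s < ?len" if "s \<in> {0<..<c}" for s
    proof -
      show "ereal s < ?len" using seg that by (auto simp: initial_segment_def)
      with that show "\<Phi> y s \<in> \<Omega>" by (intro inside) auto
    qed
    have off_N: "AE s in lborel. s \<in> {0<..<c} \<longrightarrow> \<Phi> y s \<notin> N"
      using elim(2) by eventually_elim (use seg in auto)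
    \<comment> \<open>A single good point of the curve gives the primitive identity on the whole piece before it.\<close>
    obtain s0 where s0: "0 < s0" "s0 < c" "\<Phi> y s0 \<notin> N"
      using AE_lborel_obtain_in_interval[OF off_N \<open>0 < c\<close>] .
    have "\<Phi> y \<in> borel_measurable borel"
      using continuous_flow[OF flow] by (rule borel_measurable_continuous_onI)
    then have g'm: "(\<lambda>s. g' (\<Phi> y s)) \<in> borel_measurable borel"
      using g' by measurable
    have "set_integrable lborel {0<..<c} (\<lambda>s. \<bar>g' (\<Phi> y s)\<bar>)"
      using elim(1) by (rule set_integrable_subset) (use seg in auto)
    then have q': "set_integrable lborel {0<..<c} (\<lambda>s. g' (\<Phi> y s))"
      by (subst (asm) set_integrable_abs_iff) (use g'm in \<open>auto simp: set_borel_measurable_def\<close>)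
    have ae: "AE s in lborel. s \<in> {0<..<c} \<longrightarrow> g (\<Phi> y s) = g' (\<Phi> y s)"
      using off_N
    proof eventually_elim
      case (elim s)
      then show ?case using N(3)[of "\<Phi> y s"] in_\<Omega>(1)[of s] by (auto simp: good_def)
    qed
    show ?case
    proof (rule right_limit_of_primitive[OF q' ae s0(1,2)])
      fix t assume t: "0 < t" "t < s0"
      define x where "x = \<Phi> y s0"
      have x: "\<Phi> x r = \<Phi> y (s0 + r)" for r
        unfolding x_def by (rule flow_add[OF lip flow])
      note tau = tau_on_incoming_curve[OF lip flow \<open>open \<Omega>\<close> y s0(1) in_\<Omega>(2)[of s0], folded x_def]
      have "- tau_minus \<Phi> \<Omega> x < ereal (t - s0)"
        using tau(1) s0 t by (cases "tau_minus \<Phi> \<Omega> x") auto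
      moreover have "t - s0 \<le> 0" "ereal 0 < tau_plus \<Phi> \<Omega> x"
        using t tau(2) s0 by (simp_all add: zero_ereal_def[symmetric])
      moreover have "good x" "x \<in> \<Omega>"
        using N(3) s0 in_\<Omega>(1)[of s0] by (simp_all add: x_def)
      ultimately have "fs (\<Phi> x (t - s0)) - fs (\<Phi> x 0) = (LINT r:{t - s0..0}|lebesgue. g (\<Phi> x r))"
        unfolding good_def by blast
      \<comment> \<open>Measure time from \<open>y\<close> instead of \<open>x\<close>.\<close>
      also have "\<dots> = (LINT r|lebesgue. indicator {t..s0} (s0 + 1 * r) *\<^sub>R g (\<Phi> y (s0 + 1 * r)))"
        unfolding set_lebesgue_integral_def x
        by (intro Bochner_Integration.integral_cong) (auto simp: indicator_def)
      also have "\<dots> = (LINT r:{t..s0}|lebesgue. g (\<Phi> y r))"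
        unfolding set_lebesgue_integral_def
        by (subst lebesgue_integral_real_affine[of 1 _ s0]) auto
      finally show "fs (\<Phi> y t) - fs (\<Phi> y s0) = (LINT r:{t..s0}|lebesgue. g (\<Phi> y r))"
        by (simp add: x)
    qed
  qed
qed

text \<open>
  Valid for arbitrary \<open>h\<close>: if one of the integrands fails to be integrable, so does the other, and
  both integrals are \<open>0\<close>. This matters because the identity for \<open>f\<^sup>\<sharp>\<close> is reversed at all times,
  before anything is known about \<open>g\<close> along the curve.
\<close>

lemma set_lebesgue_integral_reflect:
  fixes h :: "real \<Rightarrow> real"
  shows "(LINT s:{a..b}|lebesgue. h (- s)) = (LINT s:{- b..- a}|lebesgue. h s)"
proof -
  have "(LINT s:{- b..- a}|lebesgue. h s) =
      (LINT s|lebesgue. indicator {- b..- a} (0 + (- 1) * s) *\<^sub>R h (0 + (- 1) * s))"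
    unfolding set_lebesgue_integral_def
    by (subst lebesgue_integral_real_affine[of "- 1" _ 0]) auto
  also have "\<dots> = (LINT s:{a..b}|lebesgue. h (- s))"
    unfolding set_lebesgue_integral_def
    by (intro Bochner_Integration.integral_cong) (auto simp: indicator_def)
  finally show ?thesis ..
qed

text \<open>
  Reversing time turns the interval around and exchanges the two endpoints, so the sign of \<open>g\<close> changes.
\<close>

lemma primitive_along_reverse_flow:
  fixes g fs :: "'a \<Rightarrow> real"
  assumes "\<forall>t1 t2. - tau_minus \<Phi> \<Omega> x < ereal t1 \<and> t1 \<le> t2 \<and> ereal t2 < tau_plus \<Phi> \<Omega> x \<longrightarrow>
      fs (\<Phi> x t1) - fs (\<Phi> x t2) = (LINT s:{t1..t2}|lebesgue. g (\<Phi> x s))"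
    and t: "- tau_plus \<Phi> \<Omega> x < ereal t1" "t1 \<le> t2" "ereal t2 < tau_minus \<Phi> \<Omega> x"
  shows "fs (\<Phi> x (- t1)) - fs (\<Phi> x (- t2)) = (LINT s:{t1..t2}|lebesgue. - g (\<Phi> x (- s)))"
proof -
  have "- tau_minus \<Phi> \<Omega> x < ereal (- t2)" "ereal (- t1) < tau_plus \<Phi> \<Omega> x"
    using t by (metis ereal_minus_less_minus uminus_ereal.simps(1) ereal_uminus_uminus)+
  with assms(1) \<open>t1 \<le> t2\<close> have "fs (\<Phi> x (- t2)) - fs (\<Phi> x (- t1)) =
      (LINT s:{- t2..- t1}|lebesgue. g (\<Phi> x s))"
    by simp
  also have "\<dots> = (LINT s:{t1..t2}|lebesgue. g (\<Phi> x (- s)))"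
    by (rule set_lebesgue_integral_reflect[symmetric])
  finally show ?thesis
    by (simp add: set_lebesgue_integral_def)
qed

theorem proposition3p16:
  fixes \<mu> \<mu>m \<mu>p :: "(real ^ 'n) measure"
    and F :: "real ^ 'n \<Rightarrow> real ^ 'n"
    and \<Phi> :: "real ^ 'n \<Rightarrow> real \<Rightarrow> real ^ 'n"
    and \<Omega> :: "(real ^ 'n) set"
    and f fs g :: "real ^ 'n \<Rightarrow> real"
  assumes "radon_measure \<mu>"
    and "\<exists>L. L-lipschitz_on UNIV F"
    and "is_flow_of F \<Phi>"
    and "flow_invariant \<Phi> \<mu>"
    and "open \<Omega>"
    and "incoming_boundary_measure \<mu> \<Phi> \<Omega> \<mu>m"
    and "outgoing_boundary_measure \<mu> \<Phi> \<Omega> \<mu>p"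
    and "set_integrable \<mu> \<Omega> f"
    and "set_integrable \<mu> \<Omega> g"
    and "AE x in \<mu>. x \<in> \<Omega> \<longrightarrow> fs x = f x"
    and "AE x in \<mu>. x \<in> \<Omega> \<longrightarrow>
           (\<forall>t1 t2. - tau_minus \<Phi> \<Omega> x < ereal t1 \<and> t1 \<le> t2 \<and> ereal t2 < tau_plus \<Phi> \<Omega> x \<longrightarrow>
              fs (\<Phi> x t1) - fs (\<Phi> x t2) = (LINT s:{t1..t2}|lebesgue. g (\<Phi> x s)))"
  shows "(AE y in \<mu>m. \<exists>l. ((\<lambda>t. fs (\<Phi> y t)) \<longlongrightarrow> l) (at_right 0)) \<and>
         (AE y in \<mu>p. \<exists>l. ((\<lambda>t. fs (\<Phi> y (- t))) \<longlongrightarrow> l) (at_right 0))"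
proof
  note rad = assms(1) and flow = assms(3) and primitive = assms(11)
  obtain L where lip: "L-lipschitz_on UNIV F" using assms(2) by blast
  note sf = radon_measure_sigma_finite[OF rad]
  have space: "space \<mu>m = Gamma_minus \<Phi> \<Omega>" "space \<mu>p = Gamma_plus \<Phi> \<Omega>"
    using assms(6,7) unfolding incoming_boundary_measure_def outgoing_boundary_measure_def
    by (auto dest!: sets_eq_imp_space_eq simp: space_restrict_space)
  show "AE y in \<mu>m. \<exists>l. ((\<lambda>t. fs (\<Phi> y t)) \<longlongrightarrow> l) (at_right 0)"
    using right_limit_at_entrance[OF rad lip flow assms(5) space(1)
        incoming_measure_controls_entrance[OF assms(6) sf] assms(9) primitive] .
  let ?\<Psi> = "\<lambda>x t. \<Phi> x (- t)"
  show "AE y in \<mu>p. \<exists>l. ((\<lambda>t. fs (\<Phi> y (- t))) \<longlongrightarrow> l) (at_right 0)"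
  proof (rule right_limit_at_entrance[OF rad _ is_flow_of_reverse[OF flow] assms(5), where g = "\<lambda>x. - g x"])
    show "L-lipschitz_on UNIV (\<lambda>x. - F x)" using lip by (rule lipschitz_on_minus)
    show "space \<mu>p = Gamma_minus ?\<Psi> \<Omega>" by (simp add: space(2) Gamma_minus_reverse)
    show "controls_entrance \<mu> \<Omega> \<mu>p ?\<Psi> (length_from ?\<Psi> \<Omega>)"
      unfolding length_from_reverse by (rule outgoing_measure_controls_entrance[OF assms(7) sf])
    show "set_integrable \<mu> \<Omega> (\<lambda>x. - g x)"
      using assms(9) by (simp add: set_integrable_def)
    show "AE x in \<mu>. x \<in> \<Omega> \<longrightarrow> (\<forall>t1 t2. - tau_minus ?\<Psi> \<Omega> x < ereal t1 \<and> t1 \<le> t2 \<and>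
        ereal t2 < tau_plus ?\<Psi> \<Omega> x \<longrightarrow>
        fs (?\<Psi> x t1) - fs (?\<Psi> x t2) = (LINT s:{t1..t2}|lebesgue. - g (?\<Psi> x s)))"
      using primitive unfolding tau_plus_reverse tau_minus_reverse
      by eventually_elim (blast intro: primitive_along_reverse_flow)
  qed
qed

end
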